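(* Let $f_1,f_2:\mathbb{R}^d\to\mathbb{R}$ be in $\mathcal{C}^1$, $x_0\in\mathbb{R}^d$, $\bar\Delta>0$, and for $i\in\{1,2\}$ let $\{\widetilde f_{i,\Delta}\}_{\Delta\in(0,\bar\Delta]}$ be a class of (differentiable) models of $f_i$. Assume $f_2(x)\ne0$ and $\widetilde f_{2,\Delta}(x)\ne0$ for all $\Delta\in(0,\bar\Delta]$ and $x\in B_\Delta(x_0)$, and put $F=f_1/f_2$, $\widetilde F_\Delta=\widetilde f_{1,\Delta}/\widetilde f_{2,\Delta}$. Suppose that for $i\in\{1,2\}$ the class $\{\widetilde f_{i,\Delta}\}_{(0,\bar\Delta]}$ provides order-$N_i^f$ function accuracy of $f_i$ near $x_0$ with constant $\kappa_i^f(x_0)$, and order-$N_i^g$ gradient accuracy of $f_i$ near $x_0$, where $N_1^f,N_1^g,N_2^g\ge0$. Suppose $N_2^f>0$, and that $\bar\Delta$ is small enough that $\bar\Delta^{N_2^f}M_{\frac1{f_2}}(x_0)\kappa_2^f(x_0)<1$. Then $\{\widetilde F_\Delta\}_{(0,\bar\Delta]}$ provides order-$N_F^{fg}$ gradient accuracy of $F$ near $x_0$, where $N_F^{fg}=\min\{N_1^f,N_2^f,N_1^g,N_2^g\}$.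
   Context: $\|\cdot\|$ is the Euclidean norm and $B_\Delta(x_0)$ is the closed ball of radius $\Delta$ centered at $x_0$. $M_{\frac1{f_2}}(x_0)$ denotes a number with $|1/f_2(x)|\le M_{\frac1{f_2}}(x_0)$ for all $x\in B_{\bar\Delta}(x_0)$. A class of models of $f:\mathbb{R}^d\to\mathbb{R}$ is a family of functions $\widetilde f_\Delta:\mathbb{R}^d\to\mathbb{R}$ indexed by $\Delta\in(0,\bar\Delta]$; when gradients of models appear the models are understood to be differentiable. For real $N\ge0$, the class provides order-$N$ function (respectively gradient) accuracy of $f$ near $x_0$ with constant $\kappa\ge0$ if $|f(x)-\widetilde f_\Delta(x)|\le\kappa\Delta^N$ (respectively $\|\nabla f(x)-\nabla\widetilde f_\Delta(x)\|\le\kappa\Delta^N$) for all $\Delta\in(0,\bar\Delta]$ and $x\in B_\Delta(x_0)$. Without mention of a constant, it is meant that some such $\kappa\ge0$ exists. The quotients $F,\widetilde F_\Delta$ are considered where the denominators are nonzero; gradients at points of $B_\Delta(x_0)$ are those of the quotients (well-defined near such points by continuity of $f_2$ and $\widetilde f_{2,\Delta}$). *)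

theory Defs
  imports "HOL-Analysis.Analysis"
begin

definition gradient :: "(real ^ 'n \<Rightarrow> real) \<Rightarrow> real ^ 'n \<Rightarrow> real ^ 'n" where
  "gradient f x = (THE D. GDERIV f x :> D)"

lemma GDERIV_gradient:
  fixes f :: "real ^ 'n \<Rightarrow> real"
  assumes "f differentiable (at x)"
  shows "GDERIV f x :> gradient f x"
proof -
  obtain f' where f': "(f has_derivative f') (at x)"
    using assms by (auto simp: differentiable_def)
  then have lin: "linear f'"
    by (rule has_derivative_linear)
  have "f' = (\<lambda>h. h \<bullet> adjoint f' 1)"
    using adjoint_works[OF lin, of _ 1] by auto
  with f' have D: "GDERIV f x :> adjoint f' 1"
    by (simp add: gderiv_def)
  have "D1 = D2" if "GDERIV f x :> D1" "GDERIV f x :> D2" for D1 D2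
  proof -
    have "(\<lambda>h. h \<bullet> D1) = (\<lambda>h. h \<bullet> D2)"
      using that unfolding gderiv_def by (rule has_derivative_unique)
    then show ?thesis
      by (metis inner_commute vector_eq_ldot)
  qed
  with D show ?thesis
    unfolding gradient_def by (metis theI)
qed

definition C1 :: "(real ^ 'n \<Rightarrow> real) \<Rightarrow> bool" where
  "C1 f \<longleftrightarrow> f differentiable_on UNIV \<and> continuous_on UNIV (gradient f)"

text \<open>
  A class of models is a family indexed by the radius; only its members with index in
  \<open>{0<..\<Delta>bar}\<close> are meaningful. Exponents are real, hence \<open>powr\<close>; its base is always positive.
\<close>

definition function_accuracy ::
  "(real \<Rightarrow> real ^ 'n \<Rightarrow> real) \<Rightarrow> (real ^ 'n \<Rightarrow> real) \<Rightarrow> real ^ 'n \<Rightarrow> real \<Rightarrow> real \<Rightarrow> real \<Rightarrow> bool" where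
  "function_accuracy fm f x0 \<Delta>bar N \<kappa> \<longleftrightarrow>
     (\<forall>\<Delta>\<in>{0<..\<Delta>bar}. \<forall>x\<in>cball x0 \<Delta>. \<bar>f x - fm \<Delta> x\<bar> \<le> \<kappa> * \<Delta> powr N)"

text \<open>
  Differentiability at the points concerned is part of the definition, so that the gradients
  compared are genuine ones. It is required only pointwise because the notion is also applied to
  quotients, which need not be differentiable where the denominator vanishes.
\<close>

definition gradient_accuracy_const ::
  "(real \<Rightarrow> real ^ 'n \<Rightarrow> real) \<Rightarrow> (real ^ 'n \<Rightarrow> real) \<Rightarrow> real ^ 'n \<Rightarrow> real \<Rightarrow> real \<Rightarrow> real \<Rightarrow> bool" where
  "gradient_accuracy_const fm f x0 \<Delta>bar N \<kappa> \<longleftrightarrow>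
     (\<forall>\<Delta>\<in>{0<..\<Delta>bar}. \<forall>x\<in>cball x0 \<Delta>.
        f differentiable (at x) \<and> fm \<Delta> differentiable (at x) \<and>
        norm (gradient f x - gradient (fm \<Delta>) x) \<le> \<kappa> * \<Delta> powr N)"

definition gradient_accuracy ::
  "(real \<Rightarrow> real ^ 'n \<Rightarrow> real) \<Rightarrow> (real ^ 'n \<Rightarrow> real) \<Rightarrow> real ^ 'n \<Rightarrow> real \<Rightarrow> real \<Rightarrow> bool" where
  "gradient_accuracy fm f x0 \<Delta>bar N \<longleftrightarrow> (\<exists>\<kappa>\<ge>0. gradient_accuracy_const fm f x0 \<Delta>bar N \<kappa>)"

end

(*
  With r = 1 / f2, the quotient rule reads grad F = r grad f1 - f1 r^2 grad f2. Call a quantity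
  and its model close if the quantity is bounded and they differ by O(\<Delta>^N), where N is the minimal
  order, uniformly over the pairs (\<Delta>, x) with x in the ball of radius \<Delta>. Closeness is preserved by
  products and differences; it passes to reciprocals because the smallness of \<Delta>bar bounds the
  reciprocal of the model of f2.
*)
theory Submission
  imports Defs
begin

lemma gradient_eqI:
  assumes "GDERIV f x :> D"
  shows "gradient f x = D"
proof -
  have "D' = D" if "GDERIV f x :> D'" for D'
  proof -
    have "(\<lambda>h. h \<bullet> D') = (\<lambda>h. h \<bullet> D)"
      using that assms unfolding gderiv_def by (rule has_derivative_unique)
    then show ?thesis
      by (metis inner_commute vector_eq_ldot)
  qed
  with assms show ?thesis
    unfolding gradient_def by blast
qed

text \<open>The quotient rule, arranged so that only reciprocals, products and one difference occur.
  Each of these operations has its own closure lemma for \<open>uniformly_close\<close>, so the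
  right-hand side can be assembled term by term. The square is spelled out as a product for the same
  reason.\<close>

lemma gradient_divide:
  fixes f g :: "real ^ 'n \<Rightarrow> real"
  assumes "f differentiable (at x)" "g differentiable (at x)" "g x \<noteq> 0"
  shows "gradient (\<lambda>x. f x / g x) x =
    inverse (g x) *\<^sub>R gradient f x - (f x * (inverse (g x) * inverse (g x))) *\<^sub>R gradient g x"
proof (rule gradient_eqI)
  have "GDERIV (\<lambda>x. inverse (g x)) x :> - (inverse (g x))\<^sup>2 *\<^sub>R gradient g x"
    using GDERIV_inverse[OF GDERIV_gradient[OF assms(2)] assms(3)] .
  from GDERIV_mult[OF GDERIV_gradient[OF assms(1)] this]
  show "GDERIV (\<lambda>x. f x / g x) x :>
    inverse (g x) *\<^sub>R gradient f x - (f x * (inverse (g x) * inverse (g x))) *\<^sub>R gradient g x"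
    by (simp add: divide_inverse power2_eq_square algebra_simps)
qed

text \<open>Here \<open>p\<close> is the exact quantity, \<open>q\<close> its model and
  \<open>e\<close> the error scale. Only \<open>p\<close> is asked to be bounded: wherever
  \<open>e\<close> is bounded, \<open>q\<close> inherits a bound from the error estimate.\<close>

definition uniformly_close ::
  "'a set \<Rightarrow> ('a \<Rightarrow> real) \<Rightarrow> ('a \<Rightarrow> 'b::real_normed_vector) \<Rightarrow> ('a \<Rightarrow> 'b) \<Rightarrow> bool" where
  "uniformly_close S e p q \<longleftrightarrow>
     (\<exists>B\<ge>0. \<forall>s\<in>S. norm (p s) \<le> B) \<and> (\<exists>k\<ge>0. \<forall>s\<in>S. norm (p s - q s) \<le> k * e s)"

text \<open>Raising both constants to at least 0 preserves the bounds because \<open>e\<close> is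
  nonnegative on \<open>S\<close>. Callers can thus supply constants without checking their
  signs.\<close>

lemma uniformly_closeI:
  assumes "\<And>s. s \<in> S \<Longrightarrow> norm (p s) \<le> B" "\<And>s. s \<in> S \<Longrightarrow> norm (p s - q s) \<le> k * e s"
    and "\<And>s. s \<in> S \<Longrightarrow> 0 \<le> e s"
  shows "uniformly_close S e p q"
  unfolding uniformly_close_def
proof (intro conjI exI ballI)
  show "0 \<le> max B 0" "0 \<le> max k 0" by simp_all
  fix s assume s: "s \<in> S"
  show "norm (p s) \<le> max B 0" using assms(1)[OF s] by simp
  show "norm (p s - q s) \<le> max k 0 * e s"
    using assms(2)[OF s] mult_right_mono[OF max.cobounded1 assms(3)[OF s], of k 0] by linarith
qed

lemma uniformly_close_diff:
  assumes "uniformly_close S e p q" "uniformly_close S e p' q'"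
    and "\<And>s. s \<in> S \<Longrightarrow> 0 \<le> e s"
  shows "uniformly_close S e (\<lambda>s. p s - p' s) (\<lambda>s. q s - q' s)"
proof -
  obtain B k where B: "\<And>s. s \<in> S \<Longrightarrow> norm (p s) \<le> B"
    and k: "\<And>s. s \<in> S \<Longrightarrow> norm (p s - q s) \<le> k * e s"
    using assms(1) unfolding uniformly_close_def by blast
  obtain B' k' where B': "\<And>s. s \<in> S \<Longrightarrow> norm (p' s) \<le> B'"
    and k': "\<And>s. s \<in> S \<Longrightarrow> norm (p' s - q' s) \<le> k' * e s"
    using assms(2) unfolding uniformly_close_def by blast
  show ?thesis
  proof (rule uniformly_closeI)
    fix s assume s: "s \<in> S"
    show "norm (p s - p' s) \<le> B + B'"
      using B[OF s] B'[OF s] norm_triangle_ineq4[of "p s" "p' s"] by linarith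
    have eq: "p s - p' s - (q s - q' s) = (p s - q s) - (p' s - q' s)" by simp
    show "norm (p s - p' s - (q s - q' s)) \<le> (k + k') * e s"
      unfolding eq distrib_right
      using k[OF s] k'[OF s] norm_triangle_ineq4[of "p s - q s" "p' s - q' s"] by linarith
  qed (use assms(3) in auto)
qed

text \<open>The error of a product splits into an exact factor times the error of the other, plus an
  error times a model factor. The bound \<open>E\<close> on the error scale is what keeps the model
  factor \<open>q'\<close> bounded. Stated for \<open>scaleR\<close>, the lemma covers scalar times
  vector as well as products of reals.\<close>

lemma uniformly_close_scaleR:
  fixes p q :: "'a \<Rightarrow> real"
  assumes "uniformly_close S e p q" "uniformly_close S e p' q'"
    and e: "\<And>s. s \<in> S \<Longrightarrow> 0 \<le> e s" "\<And>s. s \<in> S \<Longrightarrow> e s \<le> E"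
  shows "uniformly_close S e (\<lambda>s. p s *\<^sub>R p' s) (\<lambda>s. q s *\<^sub>R q' s)"
proof -
  obtain B k where B: "B \<ge> 0" "\<And>s. s \<in> S \<Longrightarrow> norm (p s) \<le> B"
    and k: "k \<ge> 0" "\<And>s. s \<in> S \<Longrightarrow> norm (p s - q s) \<le> k * e s"
    using assms(1) unfolding uniformly_close_def by blast
  obtain B' k' where B': "B' \<ge> 0" "\<And>s. s \<in> S \<Longrightarrow> norm (p' s) \<le> B'"
    and k': "k' \<ge> 0" "\<And>s. s \<in> S \<Longrightarrow> norm (p' s - q' s) \<le> k' * e s"
    using assms(2) unfolding uniformly_close_def by blast
  show ?thesis
  proof (rule uniformly_closeI)
    fix s assume s: "s \<in> S"
    show "norm (p s *\<^sub>R p' s) \<le> B * B'"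
      using B(1) B(2)[OF s] B'(2)[OF s] by (simp add: mult_mono)
    have "norm (q' s) \<le> norm (p' s) + norm (p' s - q' s)"
      by (metis norm_minus_commute norm_triangle_sub)
    also have "\<dots> \<le> B' + k' * E"
      using B'(2)[OF s] k'(2)[OF s] mult_left_mono[OF e(2)[OF s] k'(1)] by linarith
    finally have q': "norm (q' s) \<le> B' + k' * E" .
    have "p s *\<^sub>R p' s - q s *\<^sub>R q' s = p s *\<^sub>R (p' s - q' s) + (p s - q s) *\<^sub>R q' s"
      by (simp add: algebra_simps)
    then have "norm (p s *\<^sub>R p' s - q s *\<^sub>R q' s)
        \<le> norm (p s) * norm (p' s - q' s) + norm (p s - q s) * norm (q' s)"
      by (metis norm_scaleR norm_triangle_ineq real_norm_def)
    also have "\<dots> \<le> B * (k' * e s) + k * e s * (B' + k' * E)"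
      using B(1) k(1) e(1)[OF s]
      by (intro add_mono mult_mono B(2) k(2) k'(2) q' s) auto
    finally show "norm (p s *\<^sub>R p' s - q s *\<^sub>R q' s) \<le> (B * k' + k * (B' + k' * E)) * e s"
      by (simp add: algebra_simps)
  qed (use e in auto)
qed

text \<open>The difference of two reciprocals is, up to sign, the difference of the arguments times
  both reciprocals. Hence uniform bounds on both reciprocals carry the error order over.\<close>

lemma uniformly_close_inverse:
  fixes p q :: "'a \<Rightarrow> real"
  assumes "uniformly_close S e p q" and e: "\<And>s. s \<in> S \<Longrightarrow> 0 \<le> e s"
    and nz: "\<And>s. s \<in> S \<Longrightarrow> p s \<noteq> 0" "\<And>s. s \<in> S \<Longrightarrow> q s \<noteq> 0"
    and M: "\<And>s. s \<in> S \<Longrightarrow> \<bar>inverse (p s)\<bar> \<le> M" "\<And>s. s \<in> S \<Longrightarrow> \<bar>inverse (q s)\<bar> \<le> M'"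
  shows "uniformly_close S e (\<lambda>s. inverse (p s)) (\<lambda>s. inverse (q s))"
proof -
  obtain k where k: "k \<ge> 0" "\<And>s. s \<in> S \<Longrightarrow> norm (p s - q s) \<le> k * e s"
    using assms(1) unfolding uniformly_close_def by blast
  show ?thesis
  proof (rule uniformly_closeI)
    fix s assume s: "s \<in> S"
    show "norm (inverse (p s)) \<le> M" using M(1)[OF s] by simp
    have M0: "0 \<le> M" using M(1)[OF s] by linarith
    have "norm (inverse (p s) - inverse (q s)) =
        \<bar>inverse (p s)\<bar> * \<bar>p s - q s\<bar> * \<bar>inverse (q s)\<bar>"
      using nz[OF s] by (simp add: inverse_diff_inverse abs_mult)
    also have "\<dots> \<le> M * (k * e s) * M'"
      using M[OF s] M0 k(1) k(2)[OF s] e[OF s] by (intro mult_mono) auto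
    finally show "norm (inverse (p s) - inverse (q s)) \<le> (M * k * M') * e s"
      by (simp add: mult_ac)
  qed (use e in auto)
qed

text \<open>From \<open>1 \<le> M * \<bar>b\<bar>\<close> the perturbation is at most
  \<open>c * \<bar>b\<bar>\<close>, a fixed fraction of \<open>b\<close> below 1. So
  \<open>\<bar>b'\<bar>\<close> is at least \<open>(1 - c) * \<bar>b\<bar>\<close>, which in turn is
  at least \<open>(1 - c) / M\<close>.\<close>

lemma abs_inverse_perturbed_le:
  fixes b b' :: real
  assumes "b \<noteq> 0" "b' \<noteq> 0" "\<bar>1 / b\<bar> \<le> M" "\<bar>b - b'\<bar> \<le> t" "t * M \<le> c" "c < 1"
  shows "\<bar>inverse b'\<bar> \<le> M / (1 - c)"
proof -
  have t0: "0 \<le> t" and M0: "0 \<le> M" using assms(3,4) by linarith+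
  have "t \<le> t * (M * \<bar>b\<bar>)"
    using assms(1,3) t0 mult_left_mono[of 1 "M * \<bar>b\<bar>" t] by (simp add: field_simps)
  also have "\<dots> \<le> c * \<bar>b\<bar>"
    using mult_right_mono[OF assms(5), of "\<bar>b\<bar>"] by (simp add: mult.assoc)
  finally have "(1 - c) * \<bar>b\<bar> \<le> \<bar>b'\<bar>"
    using assms(4) by (simp add: algebra_simps)
  moreover have "1 \<le> M * \<bar>b\<bar>"
    using assms(1,3) by (simp add: field_simps)
  then have "1 - c \<le> M * ((1 - c) * \<bar>b\<bar>)"
    using mult_left_mono[of 1 "M * \<bar>b\<bar>" "1 - c"] assms(6) by (simp add: mult_ac)
  ultimately have "1 - c \<le> M * \<bar>b'\<bar>"
    using mult_left_mono[OF _ M0] by (meson order_trans)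
  then show ?thesis
    using assms(2,6) by (simp add: field_simps)
qed

text \<open>The surplus factor \<open>x powr (n - m)\<close> is largest at \<open>x = b\<close>.
  This lets an accuracy of higher order count as one of lower order at the price of a
  constant.\<close>

lemma powr_le_mult_powr:
  fixes x b :: real
  assumes "0 < x" "x \<le> b" "m \<le> n"
  shows "x powr n \<le> b powr (n - m) * x powr m"
proof -
  have "x powr n = x powr (n - m) * x powr m"
    using assms(1) by (simp add: powr_add[symmetric])
  also have "\<dots> \<le> b powr (n - m) * x powr m"
    using assms by (intro mult_right_mono powr_mono2) auto
  finally show ?thesis .
qed

lemma continuous_on_bounded_cball:
  fixes h :: "real ^ 'n \<Rightarrow> 'b::real_normed_vector"
  assumes "continuous_on UNIV h"
  obtains B where "\<And>x. x \<in> cball x0 r \<Longrightarrow> norm (h x) \<le> B"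
proof -
  have "compact (h ` cball x0 r)"
    using assms by (intro compact_continuous_image) (auto intro: continuous_on_subset)
  then show thesis
    using that by (meson bounded_iff compact_imp_bounded imageI)
qed

text \<open>Pairing the radius with the point makes every constant in \<open>uniformly_close\<close>
  uniform in both at once, as the accuracy notions demand.\<close>

definition model_domain :: "real ^ 'n \<Rightarrow> real \<Rightarrow> (real \<times> (real ^ 'n)) set" where
  "model_domain x0 R = {(\<Delta>, x). \<Delta> \<in> {0<..R} \<and> x \<in> cball x0 \<Delta>}"

text \<open>All balls involved lie in the compact ball of radius \<open>R\<close>, which bounds
  \<open>h\<close>. The order \<open>n\<close> is lowered to the common order \<open>m\<close> at
  the cost of the factor \<open>R powr (n - m)\<close>.\<close>

lemma uniformly_close_model:
  fixes h :: "real ^ 'n \<Rightarrow> 'b::real_normed_vector"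
  assumes cont: "continuous_on UNIV h" and "0 \<le> k" "m \<le> n"
    and acc: "\<And>\<Delta> x. \<Delta> \<in> {0<..R} \<Longrightarrow> x \<in> cball x0 \<Delta> \<Longrightarrow> norm (h x - hm \<Delta> x) \<le> k * \<Delta> powr n"
  shows "uniformly_close (model_domain x0 R) (\<lambda>(\<Delta>, x). \<Delta> powr m) (\<lambda>(\<Delta>, x). h x) (\<lambda>(\<Delta>, x). hm \<Delta> x)"
proof -
  obtain B where B: "\<And>x. x \<in> cball x0 R \<Longrightarrow> norm (h x) \<le> B"
    using continuous_on_bounded_cball[OF cont] by blast
  have "norm (h x - hm \<Delta> x) \<le> (k * R powr (n - m)) * \<Delta> powr m"
    if "\<Delta> \<in> {0<..R}" "x \<in> cball x0 \<Delta>" for \<Delta> x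
  proof -
    have "norm (h x - hm \<Delta> x) \<le> k * \<Delta> powr n" using acc that .
    also have "\<dots> \<le> k * (R powr (n - m) * \<Delta> powr m)"
      using that assms(2,3) by (intro mult_left_mono powr_le_mult_powr) auto
    finally show ?thesis by (simp add: mult.assoc)
  qed
  then show ?thesis
    by (intro uniformly_closeI[where B = B and k = "k * R powr (n - m)"])
      (auto simp: model_domain_def intro!: B)
qed

theorem theorem24:
  fixes f1 f2 :: "real ^ 'n \<Rightarrow> real"
    and fm1 fm2 :: "real \<Rightarrow> real ^ 'n \<Rightarrow> real"
    and x0 :: "real ^ 'n"
    and \<Delta>bar N1f N2f N1g N2g \<kappa>1f \<kappa>2f M :: real
  assumes "C1 f1" and "C1 f2"
    and "\<Delta>bar > 0"
    and "\<forall>\<Delta>\<in>{0<..\<Delta>bar}. fm1 \<Delta> differentiable_on UNIV"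
    and "\<forall>\<Delta>\<in>{0<..\<Delta>bar}. fm2 \<Delta> differentiable_on UNIV"
    and "\<forall>\<Delta>\<in>{0<..\<Delta>bar}. \<forall>x\<in>cball x0 \<Delta>. f2 x \<noteq> 0 \<and> fm2 \<Delta> x \<noteq> 0"
    and "\<forall>x\<in>cball x0 \<Delta>bar. \<bar>1 / f2 x\<bar> \<le> M"
    and "N1f \<ge> 0" and "N2f > 0" and "N1g \<ge> 0" and "N2g \<ge> 0"
    and "\<kappa>1f \<ge> 0" and "\<kappa>2f \<ge> 0"
    and "function_accuracy fm1 f1 x0 \<Delta>bar N1f \<kappa>1f"
    and "function_accuracy fm2 f2 x0 \<Delta>bar N2f \<kappa>2f"
    and "gradient_accuracy fm1 f1 x0 \<Delta>bar N1g"
    and "gradient_accuracy fm2 f2 x0 \<Delta>bar N2g"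
    and "\<Delta>bar powr N2f * M * \<kappa>2f < 1"
  shows "gradient_accuracy (\<lambda>\<Delta> x. fm1 \<Delta> x / fm2 \<Delta> x) (\<lambda>x. f1 x / f2 x) x0 \<Delta>bar
           (Min {N1f, N2f, N1g, N2g})"
proof -
  define N where "N = Min {N1f, N2f, N1g, N2g}"
  have N: "N \<le> N1f" "N \<le> N2f" "N \<le> N1g" "N \<le> N2g" "0 \<le> N"
    using assms(8-11) unfolding N_def by auto
  define S where "S = model_domain x0 \<Delta>bar"
  define e where "e = (\<lambda>(\<Delta>::real, x::real ^ 'n). \<Delta> powr N)"
  \<comment> \<open>The upper bound uses \<open>0 \<le> N\<close>; it plays the part of
    \<open>E\<close> in the product rule.\<close>
  have e: "0 \<le> e s" "e s \<le> \<Delta>bar powr N" if "s \<in> S" for s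
    using that N(5) by (auto simp: S_def e_def model_domain_def intro!: powr_mono2)
  have diff: "f1 differentiable (at x)" "f2 differentiable (at x)" for x
    using assms(1,2) by (auto simp: C1_def differentiable_on_def)
  have diffm: "fm1 \<Delta> differentiable (at x)" "fm2 \<Delta> differentiable (at x)"
    if "\<Delta> \<in> {0<..\<Delta>bar}" for \<Delta> x
    using assms(4,5) that by (auto simp: differentiable_on_def)
  have nz: "f2 x \<noteq> 0" "fm2 \<Delta> x \<noteq> 0" if "(\<Delta>, x) \<in> S" for \<Delta> x
    using that assms(6) by (auto simp: S_def model_domain_def)
  have cont: "continuous_on UNIV f1" "continuous_on UNIV f2"
    "continuous_on UNIV (gradient f1)" "continuous_on UNIV (gradient f2)"
    using assms(1,2) by (auto simp: C1_def differentiable_imp_continuous_on)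
  obtain k1 where k1: "k1 \<ge> 0" "gradient_accuracy_const fm1 f1 x0 \<Delta>bar N1g k1"
    using assms(16) unfolding gradient_accuracy_def by blast
  obtain k2 where k2: "k2 \<ge> 0" "gradient_accuracy_const fm2 f2 x0 \<Delta>bar N2g k2"
    using assms(17) unfolding gradient_accuracy_def by blast
  have close_f1: "uniformly_close S e (\<lambda>(\<Delta>, x). f1 x) (\<lambda>(\<Delta>, x). fm1 \<Delta> x)"
    unfolding S_def e_def using assms(14)
    by (intro uniformly_close_model[OF cont(1) assms(12) N(1)]) (auto simp: function_accuracy_def)
  have close_f2: "uniformly_close S e (\<lambda>(\<Delta>, x). f2 x) (\<lambda>(\<Delta>, x). fm2 \<Delta> x)"
    unfolding S_def e_def using assms(15)
    by (intro uniformly_close_model[OF cont(2) assms(13) N(2)]) (auto simp: function_accuracy_def)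
  have close_g1: "uniformly_close S e (\<lambda>(\<Delta>, x). gradient f1 x) (\<lambda>(\<Delta>, x). gradient (fm1 \<Delta>) x)"
    unfolding S_def e_def using k1(2)
    by (intro uniformly_close_model[OF cont(3) k1(1) N(3)]) (auto simp: gradient_accuracy_const_def)
  have close_g2: "uniformly_close S e (\<lambda>(\<Delta>, x). gradient f2 x) (\<lambda>(\<Delta>, x). gradient (fm2 \<Delta>) x)"
    unfolding S_def e_def using k2(2)
    by (intro uniformly_close_model[OF cont(4) k2(1) N(4)]) (auto simp: gradient_accuracy_const_def)
  \<comment> \<open>\<open>c\<close> bounds the relative error of \<open>fm2 \<Delta>\<close>
    against \<open>f2\<close> on all of \<open>S\<close>: the exponent \<open>N2f\<close> is
    positive, so the worst case is \<open>\<Delta> = \<Delta>bar\<close>. The smallness assumption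
    says exactly \<open>c < 1\<close>.\<close>
  define c where "c = \<Delta>bar powr N2f * M * \<kappa>2f"
  have f2_inv: "\<bar>1 / f2 x\<bar> \<le> M" if "(\<Delta>, x) \<in> S" for \<Delta> x
    using that assms(7) by (auto simp: S_def model_domain_def)
  have fm2_inv: "\<bar>inverse (fm2 \<Delta> x)\<bar> \<le> M / (1 - c)" if s: "(\<Delta>, x) \<in> S" for \<Delta> x
  proof (rule abs_inverse_perturbed_le[OF nz[OF s] f2_inv[OF s]])
    show "\<bar>f2 x - fm2 \<Delta> x\<bar> \<le> \<kappa>2f * \<Delta> powr N2f"
      using s assms(15) by (auto simp: S_def model_domain_def function_accuracy_def)
    \<comment> \<open>The sign of \<open>M\<close> comes from its bounding an absolute value at the
      given point.\<close>
    have "0 \<le> M" using f2_inv[OF s] by linarith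
    moreover have "\<Delta> powr N2f \<le> \<Delta>bar powr N2f"
      using s assms(9) by (auto simp: S_def model_domain_def intro!: powr_mono2)
    ultimately have "\<Delta> powr N2f * (M * \<kappa>2f) \<le> \<Delta>bar powr N2f * (M * \<kappa>2f)"
      using assms(13) by (intro mult_right_mono) auto
    then show "\<kappa>2f * \<Delta> powr N2f * M \<le> c"
      by (simp add: c_def mult_ac)
    show "c < 1" using assms(18) by (simp add: c_def)
  qed
  have close_r: "uniformly_close S e (\<lambda>s. inverse (case s of (\<Delta>, x) \<Rightarrow> f2 x))
      (\<lambda>s. inverse (case s of (\<Delta>, x) \<Rightarrow> fm2 \<Delta> x))"
  proof (rule uniformly_close_inverse[OF close_f2 e(1)])
    show "\<bar>inverse (case s of (\<Delta>, x) \<Rightarrow> f2 x)\<bar> \<le> M" if "s \<in> S" for s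
      using f2_inv[of "fst s" "snd s"] that by (simp add: case_prod_unfold inverse_eq_divide)
  qed (use nz fm2_inv in auto)
  note close_scaleR = uniformly_close_scaleR[OF _ _ e]
  \<comment> \<open>The two sides of the difference are the quotient rule for the exact functions
    and for the models. The \<open>case\<close> expressions and the real \<open>scaleR\<close>
    reproduce literally what the closure lemmas yield; at a pair \<open>(\<Delta>, x)\<close> they
    reduce to the formula of \<open>gradient_divide\<close>.\<close>
  obtain k where "k \<ge> 0" and k: "\<And>s. s \<in> S \<Longrightarrow>
      norm ((inverse (case s of (\<Delta>, x) \<Rightarrow> f2 x) *\<^sub>R (case s of (\<Delta>, x) \<Rightarrow> gradient f1 x)
          - ((case s of (\<Delta>, x) \<Rightarrow> f1 x) *\<^sub>R (inverse (case s of (\<Delta>, x) \<Rightarrow> f2 x)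
               *\<^sub>R inverse (case s of (\<Delta>, x) \<Rightarrow> f2 x))) *\<^sub>R (case s of (\<Delta>, x) \<Rightarrow> gradient f2 x))
        - (inverse (case s of (\<Delta>, x) \<Rightarrow> fm2 \<Delta> x) *\<^sub>R (case s of (\<Delta>, x) \<Rightarrow> gradient (fm1 \<Delta>) x)
          - ((case s of (\<Delta>, x) \<Rightarrow> fm1 \<Delta> x) *\<^sub>R (inverse (case s of (\<Delta>, x) \<Rightarrow> fm2 \<Delta> x)
               *\<^sub>R inverse (case s of (\<Delta>, x) \<Rightarrow> fm2 \<Delta> x))) *\<^sub>R
             (case s of (\<Delta>, x) \<Rightarrow> gradient (fm2 \<Delta>) x))) \<le> k * e s"
    using uniformly_close_diff[OF close_scaleR[OF close_r close_g1]
        close_scaleR[OF close_scaleR[OF close_f1 close_scaleR[OF close_r close_r]] close_g2] e(1)]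
    unfolding uniformly_close_def by blast
  have "gradient_accuracy_const (\<lambda>\<Delta> x. fm1 \<Delta> x / fm2 \<Delta> x) (\<lambda>x. f1 x / f2 x) x0 \<Delta>bar N k"
    unfolding gradient_accuracy_const_def
  proof (intro ballI conjI)
    fix \<Delta> x assume \<Delta>: "\<Delta> \<in> {0<..\<Delta>bar}" and "x \<in> cball x0 \<Delta>"
    then have s: "(\<Delta>, x) \<in> S" by (simp add: S_def model_domain_def)
    show "(\<lambda>x. f1 x / f2 x) differentiable (at x)"
      using diff nz[OF s] by (intro differentiable_divide)
    show "(\<lambda>x. fm1 \<Delta> x / fm2 \<Delta> x) differentiable (at x)"
      using diffm[OF \<Delta>] nz[OF s] by (intro differentiable_divide)
    show "norm (gradient (\<lambda>x. f1 x / f2 x) x - gradient (\<lambda>x. fm1 \<Delta> x / fm2 \<Delta> x) x)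
        \<le> k * \<Delta> powr N"
      using k[OF s] nz[OF s] by (simp add: gradient_divide diff diffm[OF \<Delta>] e_def)
  qed
  with \<open>k \<ge> 0\<close> show ?thesis
    unfolding gradient_accuracy_def N_def by blast
qed

end
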